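(* Let $K$ be a ring and $\boldsymbol\delta=(\delta_1,\dots,\delta_m)$ a family of commuting derivations on $K$. Then $$H_{\mathrm{ev}}^{\boldsymbol\delta+\mathbf d_K}: (H(K),\boldsymbol\delta+\mathbf d_K)\to(H(K),\mathbf d_K)$$ is an isomorphism of differential rings with compositional inverse $H_{\mathrm{ev}}^{-\boldsymbol\delta+\mathbf d_K}$.
   Context: All rings are commutative and unital, of arbitrary characteristic. Fix a number $m$; a differential ring is a ring with an $m$-tuple of pairwise commuting derivations; differential ring homomorphisms are ring homomorphisms commuting with the respective derivations. For $\alpha,\beta\in\mathbb N^m$: $\binom{\alpha}{\beta}=\prod_i\binom{\alpha_i}{\beta_i}$, $\boldsymbol\partial^\alpha=\partial_1^{\alpha_1}\cdots\partial_m^{\alpha_m}$, $\mathbf t^\alpha=t_1^{\alpha_1}\cdots t_m^{\alpha_m}$; sums over $\alpha$ range over $\mathbb N^m$. Ring of Hurwitz series: $H(K)$ is the additive group of formal power series $\sum_\alpha a_\alpha\mathbf t^\alpha$ ($a_\alpha\in K$) with multiplication $\left(\sum_\alpha a_\alpha\mathbf t^\alpha\right)\left(\sum_\alpha b_\alpha\mathbf t^\alpha\right)=\sum_\alpha\left(\sum_{\beta+\gamma=\alpha}\binom{\alpha}{\beta}a_\beta b_\gamma\right)\mathbf t^\alpha$. The commuting derivations $\mathbf d_K=(\mathrm d_{K,1},\dots,\mathrm d_{K,m})$ on $H(K)$ are $\mathrm d_{K,i}\left(\sum_\alpha a_\alpha\mathbf t^\alpha\right)=\sum_\alpha a_{\alpha+\hat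 i}\,\mathbf t^\alpha$, where $\hat i$ is the multi-index with $1$ in position $i$ and $0$ elsewhere. $\boldsymbol\delta$ also denotes the derivations on $H(K)$ acting on coefficients: $\delta_i\left(\sum_\alpha a_\alpha\mathbf t^\alpha\right)=\sum_\alpha\delta_i(a_\alpha)\mathbf t^\alpha$. These commute with $\mathbf d_K$, and $\boldsymbol\delta+\mathbf d_K$ is the tuple $(\delta_i+\mathrm d_{K,i})_i$. Hurwitz morphism: for a differential ring $(A,\boldsymbol\partial)$ and ring homomorphism $\phi: A\to K$, $H_\phi: (A,\boldsymbol\partial)\to(H(K),\mathbf d_K)$ is the differential ring homomorphism $a\mapsto\sum_\alpha\phi(\boldsymbol\partial^\alpha a)\mathbf t^\alpha$. Let $\mathrm{ev}: H(K)\to K$ be the ring homomorphism $\sum_\alpha a_\alpha\mathbf t^\alpha\mapsto a_{(0,\dots,0)}$. For a family $\boldsymbol\delta$ of commuting derivations on $K$, $H_{\mathrm{ev}}^{\boldsymbol\delta+\mathbf d_K}$ denotes the Hurwitz morphism of $\mathrm{ev}$ with the source $H(K)$ equipped with the derivations $\boldsymbol\delta+\mathbf d_K$, i.e. $a\mapsto\sum_\alpha\mathrm{ev}\big((\boldsymbol\delta+\mathbf d_K)^\alpha a\big)\mathbf t^\alpha$; similarly for $-\boldsymbol\delta$ in place of $\boldsymbol\delta$. *)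

theory Defs
  imports "HOL-Algebra.Ring" "HOL-Library.FuncSet"
begin

section \<open>Differential rings\<close>

definition derivation :: "('a, 'b) ring_scheme \<Rightarrow> ('a \<Rightarrow> 'a) \<Rightarrow> bool" where
  "derivation R d \<longleftrightarrow>
     d \<in> carrier R \<rightarrow> carrier R \<and>
     (\<forall>x\<in>carrier R. \<forall>y\<in>carrier R. d (x \<oplus>\<^bsub>R\<^esub> y) = d x \<oplus>\<^bsub>R\<^esub> d y) \<and>
     (\<forall>x\<in>carrier R. \<forall>y\<in>carrier R.
        d (x \<otimes>\<^bsub>R\<^esub> y) = (d x \<otimes>\<^bsub>R\<^esub> y) \<oplus>\<^bsub>R\<^esub> (x \<otimes>\<^bsub>R\<^esub> d y))"

text \<open>An \<open>m\<close>-tuple is a function on \<open>nat\<close> of which only the values at \<open>0, \<dots>, m - 1\<close> matter;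
  \<open>m = 0\<close> and the zero ring are allowed.\<close>

locale differential_ring = cring R for R (structure) +
  fixes m :: nat and d :: "nat \<Rightarrow> 'a \<Rightarrow> 'a"
  assumes derivation: "i < m \<Longrightarrow> derivation R (d i)"
    and commute: "\<lbrakk>i < m; j < m; x \<in> carrier R\<rbrakk> \<Longrightarrow> d i (d j x) = d j (d i x)"

definition differential_ring_hom ::
  "nat \<Rightarrow> ('a, 'c) ring_scheme \<Rightarrow> (nat \<Rightarrow> 'a \<Rightarrow> 'a) \<Rightarrow>
   ('b, 'd) ring_scheme \<Rightarrow> (nat \<Rightarrow> 'b \<Rightarrow> 'b) \<Rightarrow> ('a \<Rightarrow> 'b) \<Rightarrow> bool" where
  "differential_ring_hom m A d B e h \<longleftrightarrow>
     differential_ring A m d \<and> differential_ring B m e \<and> h \<in> ring_hom A B \<and>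
     (\<forall>i<m. \<forall>a\<in>carrier A. h (d i a) = e i (h a))"

definition differential_ring_iso ::
  "nat \<Rightarrow> ('a, 'c) ring_scheme \<Rightarrow> (nat \<Rightarrow> 'a \<Rightarrow> 'a) \<Rightarrow>
   ('b, 'd) ring_scheme \<Rightarrow> (nat \<Rightarrow> 'b \<Rightarrow> 'b) \<Rightarrow> ('a \<Rightarrow> 'b) \<Rightarrow> bool" where
  "differential_ring_iso m A d B e h \<longleftrightarrow>
     differential_ring_hom m A d B e h \<and> bij_betw h (carrier A) (carrier B)"

definition add_family ::
  "('a, 'b) ring_scheme \<Rightarrow> (nat \<Rightarrow> 'a \<Rightarrow> 'a) \<Rightarrow> (nat \<Rightarrow> 'a \<Rightarrow> 'a) \<Rightarrow> nat \<Rightarrow> 'a \<Rightarrow> 'a" where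
  "add_family R d e = (\<lambda>i x. d i x \<oplus>\<^bsub>R\<^esub> e i x)"

definition neg_family ::
  "('a, 'b) ring_scheme \<Rightarrow> (nat \<Rightarrow> 'a \<Rightarrow> 'a) \<Rightarrow> nat \<Rightarrow> 'a \<Rightarrow> 'a" where
  "neg_family R d = (\<lambda>i x. \<ominus>\<^bsub>R\<^esub> d i x)"

section \<open>Multi-indices\<close>

text \<open>The set \<open>\<nat>\<^sup>m\<close>, each element extended by zero beyond position \<open>m - 1\<close>.\<close>

definition multi_indices :: "nat \<Rightarrow> (nat \<Rightarrow> nat) set" where
  "multi_indices m = {\<alpha>. \<forall>i\<ge>m. \<alpha> i = 0}"

definition multi_binomial :: "nat \<Rightarrow> (nat \<Rightarrow> nat) \<Rightarrow> (nat \<Rightarrow> nat) \<Rightarrow> nat" where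
  "multi_binomial m \<alpha> \<beta> = (\<Prod>i<m. \<alpha> i choose \<beta> i)"

text \<open>\<open>d 0 ^^ \<alpha> 0 \<circ> \<dots> \<circ> d (m - 1) ^^ \<alpha> (m - 1)\<close>\<close>

definition multi_deriv :: "nat \<Rightarrow> (nat \<Rightarrow> 'a \<Rightarrow> 'a) \<Rightarrow> (nat \<Rightarrow> nat) \<Rightarrow> 'a \<Rightarrow> 'a" where
  "multi_deriv m d \<alpha> = foldr (\<lambda>i f. (d i ^^ \<alpha> i) \<circ> f) [0..<m] id"

section \<open>Hurwitz series\<close>

text \<open>A series is its coefficient function, extensional (i.e. \<open>undefined\<close>) off \<open>multi_indices m\<close>,
  so that equality of series is equality of functions.\<close>

definition hurwitz_ring :: "nat \<Rightarrow> ('a, 'b) ring_scheme \<Rightarrow> ((nat \<Rightarrow> nat) \<Rightarrow> 'a) ring" where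
  "hurwitz_ring m K =
     \<lparr>carrier = multi_indices m \<rightarrow>\<^sub>E carrier K,
      mult = (\<lambda>a b. \<lambda>\<alpha>\<in>multi_indices m.
        finsum K (\<lambda>(\<beta>, \<gamma>). [multi_binomial m \<alpha> \<beta>] \<cdot>\<^bsub>K\<^esub> (a \<beta> \<otimes>\<^bsub>K\<^esub> b \<gamma>))
          {(\<beta>, \<gamma>). \<beta> \<in> multi_indices m \<and> \<gamma> \<in> multi_indices m \<and>
                    (\<lambda>i. \<beta> i + \<gamma> i) = \<alpha>}),
      one = (\<lambda>\<alpha>\<in>multi_indices m. if \<alpha> = (\<lambda>_. 0) then \<one>\<^bsub>K\<^esub> else \<zero>\<^bsub>K\<^esub>),
      zero = (\<lambda>\<alpha>\<in>multi_indices m. \<zero>\<^bsub>K\<^esub>),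
      add = (\<lambda>a b. \<lambda>\<alpha>\<in>multi_indices m. a \<alpha> \<oplus>\<^bsub>K\<^esub> b \<alpha>)\<rparr>"

definition hurwitz_deriv ::
  "nat \<Rightarrow> nat \<Rightarrow> ((nat \<Rightarrow> nat) \<Rightarrow> 'a) \<Rightarrow> (nat \<Rightarrow> nat) \<Rightarrow> 'a" where
  "hurwitz_deriv m i a = (\<lambda>\<alpha>\<in>multi_indices m. a (\<alpha>(i := \<alpha> i + 1)))"

definition coeff_deriv ::
  "nat \<Rightarrow> (nat \<Rightarrow> 'a \<Rightarrow> 'a) \<Rightarrow> nat \<Rightarrow> ((nat \<Rightarrow> nat) \<Rightarrow> 'a) \<Rightarrow> (nat \<Rightarrow> nat) \<Rightarrow> 'a" where
  "coeff_deriv m \<delta> i a = (\<lambda>\<alpha>\<in>multi_indices m. \<delta> i (a \<alpha>))"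

text \<open>The Hurwitz morphism of \<open>\<phi>\<close>, whose source carries the derivations \<open>d\<close>.\<close>

definition hurwitz_morphism ::
  "nat \<Rightarrow> (nat \<Rightarrow> 'a \<Rightarrow> 'a) \<Rightarrow> ('a \<Rightarrow> 'b) \<Rightarrow> 'a \<Rightarrow> (nat \<Rightarrow> nat) \<Rightarrow> 'b" where
  "hurwitz_morphism m d \<phi> a = (\<lambda>\<alpha>\<in>multi_indices m. \<phi> (multi_deriv m d \<alpha> a))"

definition hurwitz_ev :: "((nat \<Rightarrow> nat) \<Rightarrow> 'a) \<Rightarrow> 'a" where
  "hurwitz_ev a = a (\<lambda>_. 0)"

text \<open>The derivations \<open>\<delta> + d\<^sub>K\<close> on \<open>H(K)\<close>.\<close>

definition twisted_deriv ::
  "nat \<Rightarrow> ('a, 'b) ring_scheme \<Rightarrow> (nat \<Rightarrow> 'a \<Rightarrow> 'a) \<Rightarrow>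
   nat \<Rightarrow> ((nat \<Rightarrow> nat) \<Rightarrow> 'a) \<Rightarrow> (nat \<Rightarrow> nat) \<Rightarrow> 'a" where
  "twisted_deriv m K \<delta> = add_family (hurwitz_ring m K) (coeff_deriv m \<delta>) (hurwitz_deriv m)"

end

theory Submission
  imports Defs
begin

text \<open>A Hurwitz series is determined by its constant term together with its derivatives, and the
  product is the one for which evaluation at zero is multiplicative and the \<open>d\<^sub>i\<close> are derivations.
  Hence every identity below is proved coefficientwise by induction on the multi-index, for all
  series simultaneously: the step raising \<open>\<alpha> i\<close> by one replaces the series by their \<open>d\<^sub>i\<close>-derivatives.
  Let \<open>F\<close> and \<open>G\<close> be the Hurwitz morphisms of \<open>\<delta> + d\<close> and \<open>-\<delta> + d\<close>. Since \<open>F\<close> also commutes with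
  \<open>\<delta>\<close>, we get \<open>F \<circ> d\<^sub>i = (-\<delta>\<^sub>i + d\<^sub>i) \<circ> F\<close>, so \<open>G \<circ> F\<close> commutes with every \<open>d\<^sub>i\<close> and preserves the
  constant term; thus it is the identity.\<close>

section \<open>Multi-indices\<close>

lemma zero_multi_index [simp]: "(\<lambda>_. 0) \<in> multi_indices m"
  by (simp add: multi_indices_def)

lemma Suc_multi_index [simp]:
  "\<lbrakk>\<alpha> \<in> multi_indices m; i < m\<rbrakk> \<Longrightarrow> \<alpha>(i := Suc (\<alpha> i)) \<in> multi_indices m"
  by (simp add: multi_indices_def)

lemma Suc_multi_index_neq_zero [simp]: "\<alpha>(i := Suc k) \<noteq> (\<lambda>_. 0)"
  by (metis Zero_not_Suc fun_upd_same)

text \<open>Induction on the total degree: a nonzero multi-index has a positive entry at some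
  \<open>i < m\<close>, and lowering that entry by one gives the predecessor. Each step thus
  corresponds to a single derivation.\<close>

lemma multi_index_induct [consumes 1, case_names zero Suc]:
  assumes "\<alpha> \<in> multi_indices m"
    and zero: "P (\<lambda>_. 0)"
    and Suc: "\<And>\<alpha> i. \<lbrakk>\<alpha> \<in> multi_indices m; i < m; P \<alpha>\<rbrakk> \<Longrightarrow> P (\<alpha>(i := Suc (\<alpha> i)))"
  shows "P \<alpha>"
  using assms(1)
proof (induction "\<Sum>i<m. \<alpha> i" arbitrary: \<alpha>)
  case 0
  then have "\<alpha> = (\<lambda>_. 0)"
    by (fastforce simp: multi_indices_def not_less[symmetric])
  then show ?case using zero by simp
next
  case (Suc n)
  then obtain i where i: "i < m" "\<alpha> i \<noteq> 0"
    by (metis lessThan_iff nat.distinct(1) sum.neutral)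
  define \<beta> where "\<beta> = \<alpha>(i := \<alpha> i - 1)"
  have \<alpha>: "\<alpha> = \<beta>(i := Suc (\<beta> i))" using i by (auto simp: \<beta>_def)
  have \<beta>: "\<beta> \<in> multi_indices m" using Suc.prems i by (auto simp: \<beta>_def multi_indices_def)
  have "(\<Sum>j<m. \<alpha> j) = \<alpha> i + (\<Sum>j\<in>{..<m} - {i}. \<alpha> j)"
    using i by (simp add: sum.remove)
  moreover have "(\<Sum>j<m. \<beta> j) = (\<alpha> i - 1) + (\<Sum>j\<in>{..<m} - {i}. \<alpha> j)"
    using i by (simp add: sum.remove[of _ i] \<beta>_def)
  ultimately have "n = (\<Sum>j<m. \<beta> j)" using Suc.hyps(2) i by simp
  from Suc.hyps(1)[OF this \<beta>] assms(3)[OF \<beta> i(1)] show ?case by (metis \<alpha>)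
qed

section \<open>Decompositions of a multi-index into two summands\<close>

definition multi_splits :: "nat \<Rightarrow> (nat \<Rightarrow> nat) \<Rightarrow> ((nat \<Rightarrow> nat) \<times> (nat \<Rightarrow> nat)) set" where
  "multi_splits m \<alpha> = {(\<beta>, \<gamma>). \<beta> \<in> multi_indices m \<and> \<gamma> \<in> multi_indices m \<and>
                              (\<lambda>i. \<beta> i + \<gamma> i) = \<alpha>}"

lemma multi_splits_zero: "multi_splits m (\<lambda>_. 0) = {(\<lambda>_. 0, \<lambda>_. 0)}"
  by (auto simp: multi_splits_def fun_eq_iff multi_indices_def)

lemma finite_multi_splits [simp]:
  assumes "\<alpha> \<in> multi_indices m"
  shows "finite (multi_splits m \<alpha>)"
proof -
  \<comment> \<open>\<open>finite_set_of_finite_funs\<close> takes one finite set of values for all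
    positions, so entries are bounded by the total degree of \<open>\<alpha>\<close> instead of by
    \<open>\<alpha> i\<close>.\<close>
  let ?B = "{f. \<forall>i. (i \<in> {..<m} \<longrightarrow> f i \<in> {..sum \<alpha> {..<m}}) \<and> (i \<notin> {..<m} \<longrightarrow> f i = 0)}"
  have fin: "finite ?B"
    by (rule finite_set_of_finite_funs) simp_all
  have "f \<in> ?B" if f: "f \<in> multi_indices m" "\<And>i. f i \<le> \<alpha> i" for f
  proof -
    have "f i \<le> sum \<alpha> {..<m}" if "i < m" for i
      using that by (intro order_trans[OF f(2)] member_le_sum) auto
    then show ?thesis using f(1) by (simp add: multi_indices_def)
  qed
  then have "multi_splits m \<alpha> \<subseteq> ?B \<times> ?B"
    unfolding multi_splits_def by (intro subsetI) auto
  then show ?thesis using fin by (meson finite_SigmaI finite_subset)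
qed

text \<open>Pascal's rule in the factor at \<open>i\<close>; the factors at all other positions are
  common to the three products.\<close>

lemma multi_binomial_Suc_right:
  assumes "i < m"
  shows "multi_binomial m (\<alpha>(i := Suc (\<alpha> i))) (\<beta>(i := Suc (\<beta> i))) =
    multi_binomial m \<alpha> \<beta> + multi_binomial m \<alpha> (\<beta>(i := Suc (\<beta> i)))"
proof -
  have *: "multi_binomial m a b = (a i choose b i) * (\<Prod>j\<in>{..<m} - {i}. a j choose b j)" for a b
    using assms by (simp add: multi_binomial_def prod.remove)
  show ?thesis
    unfolding * by (simp add: add_mult_distrib cong: prod.cong_simp)
qed

text \<open>The boundary case of Pascal's rule: choosing 0 at position \<open>i\<close> gives 1
  before and after raising.\<close>

lemma multi_binomial_Suc_left:
  assumes "i < m" "\<beta> i = 0"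
  shows "multi_binomial m (\<alpha>(i := Suc (\<alpha> i))) \<beta> = multi_binomial m \<alpha> \<beta>"
  unfolding multi_binomial_def using assms by (intro prod.cong) auto

lemma multi_binomial_eq_0:
  assumes "i < m" "\<alpha> i < \<beta> i"
  shows "multi_binomial m \<alpha> \<beta> = 0"
  unfolding multi_binomial_def using assms by (intro prod_zero) auto

section \<open>Differential rings\<close>

context differential_ring
begin

lemma deriv_closed [simp]: "\<lbrakk>i < m; x \<in> carrier R\<rbrakk> \<Longrightarrow> d i x \<in> carrier R"
  using derivation[of i] by (auto simp: derivation_def)

lemma deriv_add: "\<lbrakk>i < m; x \<in> carrier R; y \<in> carrier R\<rbrakk> \<Longrightarrow> d i (x \<oplus> y) = d i x \<oplus> d i y"
  using derivation[of i] by (auto simp: derivation_def)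

lemma deriv_mult:
  "\<lbrakk>i < m; x \<in> carrier R; y \<in> carrier R\<rbrakk> \<Longrightarrow> d i (x \<otimes> y) = (d i x \<otimes> y) \<oplus> (x \<otimes> d i y)"
  using derivation[of i] by (auto simp: derivation_def)

lemma deriv_zero: "i < m \<Longrightarrow> d i \<zero> = \<zero>"
  using deriv_add[of i \<zero> \<zero>] by (metis add.r_cancel_one deriv_closed l_zero zero_closed)

lemma deriv_one: "i < m \<Longrightarrow> d i \<one> = \<zero>"
  using deriv_mult[of i \<one> \<one>] by (metis add.r_cancel_one deriv_closed l_one r_one one_closed)

lemma deriv_minus: "\<lbrakk>i < m; x \<in> carrier R\<rbrakk> \<Longrightarrow> d i (\<ominus> x) = \<ominus> d i x"
  using deriv_add[of i "\<ominus> x" x] deriv_zero[of i]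
  by (metis a_inv_closed deriv_closed l_neg minus_equality)

lemma differential_ring_neg_family: "differential_ring R m (neg_family R d)"
proof unfold_locales
  fix i assume "i < m"
  then show "derivation R (neg_family R d i)"
    by (auto simp: derivation_def neg_family_def deriv_add deriv_mult minus_add l_minus r_minus)
next
  fix i j x assume "i < m" "j < m" "x \<in> carrier R"
  then show "neg_family R d i (neg_family R d j x) = neg_family R d j (neg_family R d i x)"
    by (simp add: neg_family_def deriv_minus commute)
qed

section \<open>Iterated derivations\<close>

lemma funpow_deriv_closed:
  "\<lbrakk>i < m; x \<in> carrier R\<rbrakk> \<Longrightarrow> (d i ^^ n) x \<in> carrier R"
  by (induction n) auto

text \<open>The lists generalize \<open>[0..<m]\<close> in the definition of \<^const>\<open>multi_deriv\<close>, for induction.\<close>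

lemma foldr_deriv_closed:
  "\<lbrakk>set is \<subseteq> {..<m}; x \<in> carrier R\<rbrakk> \<Longrightarrow> foldr (\<lambda>i f. (d i ^^ \<alpha> i) \<circ> f) is id x \<in> carrier R"
  by (induction "is") (auto simp: funpow_deriv_closed)

text \<open>The map \<open>e\<close> is kept general for two uses: \<open>e = d i\<close> in
  \<open>foldr_deriv_Suc\<close>, and, through \<open>multi_deriv_commute\<close>, a coefficientwise
  derivation against the twisted ones.\<close>

lemma foldr_deriv_commute:
  assumes "\<And>x. x \<in> carrier R \<Longrightarrow> e x \<in> carrier R"
    and "\<And>i x. \<lbrakk>i < m; x \<in> carrier R\<rbrakk> \<Longrightarrow> e (d i x) = d i (e x)"
    and "set is \<subseteq> {..<m}" "x \<in> carrier R"
  shows "e (foldr (\<lambda>i f. (d i ^^ \<alpha> i) \<circ> f) is id x) = foldr (\<lambda>i f. (d i ^^ \<alpha> i) \<circ> f) is id (e x)"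
proof -
  have *: "e ((d i ^^ n) x) = (d i ^^ n) (e x)" if "i < m" "x \<in> carrier R" for i n x
    using that by (induction n) (auto simp: assms funpow_deriv_closed)
  show ?thesis
    using assms(3,4) by (induction "is") (auto simp: * foldr_deriv_closed)
qed

text \<open>The extra \<open>d i\<close> arises at the place of \<open>i\<close> in the list and
  moves inward past the derivations listed after \<open>i\<close>, with which it commutes.
  Distinctness keeps the raised exponent from occurring twice.\<close>

lemma foldr_deriv_Suc:
  assumes "distinct is" "i \<in> set is" "set is \<subseteq> {..<m}" "x \<in> carrier R"
  shows "foldr (\<lambda>j f. (d j ^^ (\<alpha>(i := Suc (\<alpha> i))) j) \<circ> f) is id x
    = foldr (\<lambda>j f. (d j ^^ \<alpha> j) \<circ> f) is id (d i x)"
  using assms(1-3)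
proof (induction "is")
  case (Cons j js)
  show ?case
  proof (cases "j = i")
    case True
    have same: "foldr (\<lambda>j f. (d j ^^ (\<alpha>(i := Suc (\<alpha> i))) j) \<circ> f) js id
        = foldr (\<lambda>j f. (d j ^^ \<alpha> j) \<circ> f) js id"
      using True Cons.prems(1) by (intro foldr_cong) auto
    have swap: "d i (foldr (\<lambda>j f. (d j ^^ \<alpha> j) \<circ> f) js id x)
        = foldr (\<lambda>j f. (d j ^^ \<alpha> j) \<circ> f) js id (d i x)"
      using Cons.prems True assms(4) by (intro foldr_deriv_commute) (auto simp: commute)
    have "foldr (\<lambda>j f. (d j ^^ (\<alpha>(i := Suc (\<alpha> i))) j) \<circ> f) (j # js) id x
        = (d i ^^ Suc (\<alpha> i)) (foldr (\<lambda>j f. (d j ^^ (\<alpha>(i := Suc (\<alpha> i))) j) \<circ> f) js id x)"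
      by (simp add: True)
    also have "\<dots> = (d i ^^ \<alpha> i) (d i (foldr (\<lambda>j f. (d j ^^ \<alpha> j) \<circ> f) js id x))"
      unfolding same by (simp add: funpow_swap1)
    also have "\<dots> = foldr (\<lambda>j f. (d j ^^ \<alpha> j) \<circ> f) (j # js) id (d i x)"
      unfolding swap by (simp add: True)
    finally show ?thesis .
  next
    case False
    then show ?thesis using Cons by simp
  qed
qed simp

lemma multi_deriv_zero: "multi_deriv m d (\<lambda>_. 0) x = x"
proof -
  have "foldr (\<lambda>i f. (d i ^^ 0) \<circ> f) is id = id" for "is" :: "nat list"
    by (induction "is") auto
  then show ?thesis by (simp add: multi_deriv_def)
qed

lemma multi_deriv_closed: "x \<in> carrier R \<Longrightarrow> multi_deriv m d \<alpha> x \<in> carrier R"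
  unfolding multi_deriv_def by (rule foldr_deriv_closed) auto

lemma multi_deriv_commute:
  assumes "\<And>x. x \<in> carrier R \<Longrightarrow> e x \<in> carrier R"
    and "\<And>i x. \<lbrakk>i < m; x \<in> carrier R\<rbrakk> \<Longrightarrow> e (d i x) = d i (e x)"
    and "x \<in> carrier R"
  shows "e (multi_deriv m d \<alpha> x) = multi_deriv m d \<alpha> (e x)"
  unfolding multi_deriv_def using assms by (intro foldr_deriv_commute) auto

text \<open>With the new derivation innermost, a coefficient of a Hurwitz morphism at the raised
  index becomes a coefficient at \<open>\<alpha>\<close> of the image of \<open>d i x\<close>, the
  form that the inductions use.\<close>

lemma multi_deriv_Suc:
  "\<lbrakk>i < m; x \<in> carrier R\<rbrakk> \<Longrightarrow>
    multi_deriv m d (\<alpha>(i := Suc (\<alpha> i))) x = multi_deriv m d \<alpha> (d i x)"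
  unfolding multi_deriv_def by (intro foldr_deriv_Suc) auto

end

section \<open>The ring of Hurwitz series\<close>

text \<open>No derivations on \<open>K\<close> are fixed, so that two families, \<delta> and its
  negative, can later be treated over the same \<open>K\<close>.\<close>

locale hurwitz_series = cring K for K :: "('a, 'b) ring_scheme" (structure) + fixes m :: nat
begin

abbreviation "H \<equiv> hurwitz_ring m K"

lemma coeff_closed [simp]: "\<lbrakk>a \<in> carrier H; \<alpha> \<in> multi_indices m\<rbrakk> \<Longrightarrow> a \<alpha> \<in> carrier K"
  by (auto simp: hurwitz_ring_def)

lemma hurwitz_eqI:
  "\<lbrakk>a \<in> carrier H; b \<in> carrier H; \<And>\<alpha>. \<alpha> \<in> multi_indices m \<Longrightarrow> a \<alpha> = b \<alpha>\<rbrakk> \<Longrightarrow> a = b"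
  by (auto simp: hurwitz_ring_def intro: PiE_ext)

lemma restrict_closed:
  "(\<And>\<alpha>. \<alpha> \<in> multi_indices m \<Longrightarrow> f \<alpha> \<in> carrier K) \<Longrightarrow> (\<lambda>\<alpha>\<in>multi_indices m. f \<alpha>) \<in> carrier H"
  by (auto simp: hurwitz_ring_def)

lemma coeff_add: "\<alpha> \<in> multi_indices m \<Longrightarrow> (a \<oplus>\<^bsub>H\<^esub> b) \<alpha> = a \<alpha> \<oplus> b \<alpha>"
  by (simp add: hurwitz_ring_def)

lemma coeff_zero: "\<alpha> \<in> multi_indices m \<Longrightarrow> \<zero>\<^bsub>H\<^esub> \<alpha> = \<zero>"
  by (simp add: hurwitz_ring_def)

lemma coeff_one: "\<alpha> \<in> multi_indices m \<Longrightarrow> \<one>\<^bsub>H\<^esub> \<alpha> = (if \<alpha> = (\<lambda>_. 0) then \<one> else \<zero>)"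
  by (simp add: hurwitz_ring_def)

lemma coeff_deriv: "\<alpha> \<in> multi_indices m \<Longrightarrow> hurwitz_deriv m i a \<alpha> = a (\<alpha>(i := Suc (\<alpha> i)))"
  by (simp add: hurwitz_deriv_def)

lemma coeff_mult:
  "\<alpha> \<in> multi_indices m \<Longrightarrow> (a \<otimes>\<^bsub>H\<^esub> b) \<alpha> =
    finsum K (\<lambda>(\<beta>, \<gamma>). [multi_binomial m \<alpha> \<beta>] \<cdot> (a \<beta> \<otimes> b \<gamma>)) (multi_splits m \<alpha>)"
  by (simp add: hurwitz_ring_def multi_splits_def)

lemma add_H_closed [simp]: "\<lbrakk>a \<in> carrier H; b \<in> carrier H\<rbrakk> \<Longrightarrow> a \<oplus>\<^bsub>H\<^esub> b \<in> carrier H"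
  by (auto simp: hurwitz_ring_def)

lemma zero_H_closed [simp]: "\<zero>\<^bsub>H\<^esub> \<in> carrier H"
  by (auto simp: hurwitz_ring_def)

lemma one_H_closed [simp]: "\<one>\<^bsub>H\<^esub> \<in> carrier H"
  by (auto simp: hurwitz_ring_def)

lemma hurwitz_deriv_closed [simp]: "\<lbrakk>i < m; a \<in> carrier H\<rbrakk> \<Longrightarrow> hurwitz_deriv m i a \<in> carrier H"
  unfolding hurwitz_deriv_def by (rule restrict_closed) simp

lemma mult_H_closed [simp]:
  assumes "a \<in> carrier H" "b \<in> carrier H"
  shows "a \<otimes>\<^bsub>H\<^esub> b \<in> carrier H"
proof -
  have "(a \<otimes>\<^bsub>H\<^esub> b) \<alpha> \<in> carrier K" if "\<alpha> \<in> multi_indices m" for \<alpha>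
    unfolding coeff_mult[OF that] using assms
    by (intro finsum_closed) (auto simp: multi_splits_def)
  moreover have "a \<otimes>\<^bsub>H\<^esub> b \<in> extensional (multi_indices m)"
    by (simp add: hurwitz_ring_def)
  ultimately show ?thesis by (auto simp: hurwitz_ring_def PiE_iff)
qed

text \<open>The only split of 0 is (0, 0), with binomial 1. Together with
  \<open>mult_coeff_Suc\<close> this determines the product; after that lemma no proof unfolds the
  defining sum.\<close>

lemma mult_coeff_zero:
  "\<lbrakk>a \<in> carrier H; b \<in> carrier H\<rbrakk> \<Longrightarrow> (a \<otimes>\<^bsub>H\<^esub> b) (\<lambda>_. 0) = a (\<lambda>_. 0) \<otimes> b (\<lambda>_. 0)"
  by (simp add: coeff_mult multi_splits_zero multi_binomial_def)

text \<open>The Leibniz rule for \<open>d\<^sub>i\<close>. By Pascal's rule the summand of \<open>(\<beta>, \<gamma>)\<close> at the raised index splits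
  into \<open>?f\<close>, supported on \<open>\<beta> i > 0\<close>, and \<open>?g\<close>, supported on \<open>\<gamma> i > 0\<close>.\<close>

lemma mult_coeff_Suc:
  assumes a: "a \<in> carrier H" and b: "b \<in> carrier H" and \<alpha>: "\<alpha> \<in> multi_indices m" and i: "i < m"
  shows "(a \<otimes>\<^bsub>H\<^esub> b) (\<alpha>(i := Suc (\<alpha> i))) =
    (hurwitz_deriv m i a \<otimes>\<^bsub>H\<^esub> b) \<alpha> \<oplus> (a \<otimes>\<^bsub>H\<^esub> hurwitz_deriv m i b) \<alpha>"
proof -
  let ?\<alpha>' = "\<alpha>(i := Suc (\<alpha> i))"
  let ?S = "multi_splits m \<alpha>" and ?S' = "multi_splits m ?\<alpha>'"
  let ?up = "\<lambda>\<beta>. \<beta>(i := Suc (\<beta> i))" and ?down = "\<lambda>\<beta>. \<beta>(i := \<beta> i - 1)"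
  \<comment> \<open>The guard matters because \<open>0 - 1 = 0\<close> on naturals: at
    \<open>\<beta> i = 0\<close> the map \<open>?down\<close> fixes \<open>\<beta>\<close>, and an
    unguarded \<open>?f\<close> would repeat the summand \<open>?g\<close>.\<close>
  let ?f = "\<lambda>(\<beta>, \<gamma>). if \<beta> i = 0 then \<zero> else [multi_binomial m \<alpha> (?down \<beta>)] \<cdot> (a \<beta> \<otimes> b \<gamma>)"
  let ?g = "\<lambda>(\<beta>, \<gamma>). [multi_binomial m \<alpha> \<beta>] \<cdot> (a \<beta> \<otimes> b \<gamma>)"
  have S': "?S' \<subseteq> multi_indices m \<times> multi_indices m" and S: "?S \<subseteq> multi_indices m \<times> multi_indices m"
    by (auto simp: multi_splits_def)
  have fc: "?f \<in> ?S' \<rightarrow> carrier K" and gc: "?g \<in> ?S' \<rightarrow> carrier K"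
    using S' a b by auto
  have inj: "inj ?up"
    by (rule injI) (metis fun_upd_eqD fun_upd_triv fun_upd_upd nat.inject)
  have split: "[multi_binomial m ?\<alpha>' \<beta>] \<cdot> (a \<beta> \<otimes> b \<gamma>) = ?f (\<beta>, \<gamma>) \<oplus> ?g (\<beta>, \<gamma>)"
    if "(\<beta>, \<gamma>) \<in> ?S'" for \<beta> \<gamma>
  proof (cases "\<beta> i")
    case 0
    then show ?thesis using that S' a b i multi_binomial_Suc_left by auto
  next
    case (Suc n)
    then have "\<beta> = ?up (?down \<beta>)" by auto
    with multi_binomial_Suc_right[OF i, of \<alpha> "?down \<beta>"]
    have "multi_binomial m ?\<alpha>' \<beta> = multi_binomial m \<alpha> (?down \<beta>) + multi_binomial m \<alpha> \<beta>" by metis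
    then show ?thesis using Suc that S' a b by (auto simp: add.nat_pow_mult)
  qed
  have f: "(\<Oplus>p\<in>?S'. ?f p) = (hurwitz_deriv m i a \<otimes>\<^bsub>H\<^esub> b) \<alpha>"
  proof -
    \<comment> \<open>Raising the first component embeds the splits of \<open>\<alpha>\<close> into
      those of \<open>?\<alpha>'\<close>. A split with \<open>\<beta> i > 0\<close> lies in the
      image, as lowering \<open>\<beta>\<close> shows, so off the image the guard makes
      \<open>?f\<close> vanish.\<close>
    let ?h = "\<lambda>(\<beta>, \<gamma>). (?up \<beta>, \<gamma>)"
    have im: "?h ` ?S \<subseteq> ?S'"
      using i by (auto simp: multi_splits_def fun_eq_iff)
    have off: "?f p = \<zero>" if "p \<in> ?S' - ?h ` ?S" for p
    proof -
      obtain \<beta> \<gamma> where p: "p = (\<beta>, \<gamma>)" by (cases p)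
      have "\<beta> i = 0"
      proof (rule ccontr)
        assume ne: "\<beta> i \<noteq> 0"
        have "\<beta> j + \<gamma> j = ?\<alpha>' j" for j using that p by (auto simp: multi_splits_def fun_eq_iff)
        then have "?down \<beta> j + \<gamma> j = \<alpha> j" for j
          using ne by (cases "j = i") (auto simp: fun_eq_iff split: if_splits dest: spec[of _ j])
        then have "(?down \<beta>, \<gamma>) \<in> ?S"
          using that p by (auto simp: multi_splits_def multi_indices_def)
        moreover have "p = ?h (?down \<beta>, \<gamma>)" using p ne by auto
        ultimately show False using that by blast
      qed
      then show ?thesis by (simp add: p)
    qed
    have "(\<Oplus>p\<in>?S'. ?f p) = (\<Oplus>p\<in>?h ` ?S. ?f p)"
      using im off fc \<alpha> i by (intro add.finprod_mono_neutral_cong_right) auto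
    also have "\<dots> = (\<Oplus>p\<in>?S. ?f (?h p))"
      using S a b i inj by (intro finsum_reindex) (auto simp: inj_on_def inj_def)
    also have "\<dots> = (hurwitz_deriv m i a \<otimes>\<^bsub>H\<^esub> b) \<alpha>"
      unfolding coeff_mult[OF \<alpha>] using S a b i
      by (intro finsum_cong') (auto simp: coeff_deriv)
    finally show ?thesis .
  qed
  have g: "(\<Oplus>p\<in>?S'. ?g p) = (a \<otimes>\<^bsub>H\<^esub> hurwitz_deriv m i b) \<alpha>"
  proof -
    let ?h = "\<lambda>(\<beta>, \<gamma>). (\<beta>, ?up \<gamma>)"
    have im: "?h ` ?S \<subseteq> ?S'"
      using i by (auto simp: multi_splits_def fun_eq_iff)
    have off: "?g p = \<zero>" if "p \<in> ?S' - ?h ` ?S" for p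
    proof -
      obtain \<beta> \<gamma> where p: "p = (\<beta>, \<gamma>)" by (cases p)
      have sum: "\<beta> j + \<gamma> j = ?\<alpha>' j" for j using that p by (auto simp: multi_splits_def fun_eq_iff)
      have "\<gamma> i = 0"
      proof (rule ccontr)
        assume ne: "\<gamma> i \<noteq> 0"
        have "\<beta> j + ?down \<gamma> j = \<alpha> j" for j
          using ne sum[of j] by (cases "j = i") auto
        then have "(\<beta>, ?down \<gamma>) \<in> ?S"
          using that p by (auto simp: multi_splits_def multi_indices_def)
        moreover have "p = ?h (\<beta>, ?down \<gamma>)" using p ne by auto
        ultimately show False using that by blast
      qed
      \<comment> \<open>Now \<open>\<beta> i = Suc (\<alpha> i)\<close> exceeds
        \<open>\<alpha> i\<close>, so the binomial itself vanishes and does for \<open>?g\<close>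
        what the guard does for \<open>?f\<close>.\<close>
      then have "multi_binomial m \<alpha> \<beta> = 0"
        using sum[of i] i by (intro multi_binomial_eq_0) auto
      then show ?thesis by (simp add: p)
    qed
    have "(\<Oplus>p\<in>?S'. ?g p) = (\<Oplus>p\<in>?h ` ?S. ?g p)"
      using im off gc \<alpha> i by (intro add.finprod_mono_neutral_cong_right) auto
    also have "\<dots> = (\<Oplus>p\<in>?S. ?g (?h p))"
      using S a b i inj by (intro finsum_reindex) (auto simp: inj_on_def inj_def)
    also have "\<dots> = (a \<otimes>\<^bsub>H\<^esub> hurwitz_deriv m i b) \<alpha>"
      unfolding coeff_mult[OF \<alpha>] using S a b i
      by (intro finsum_cong') (auto simp: coeff_deriv)
    finally show ?thesis .
  qed
  have "(a \<otimes>\<^bsub>H\<^esub> b) ?\<alpha>' = (\<Oplus>p\<in>?S'. ?f p \<oplus> ?g p)"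
    unfolding coeff_mult[OF Suc_multi_index[OF \<alpha> i]] using split fc gc
    by (intro finsum_cong') (auto simp: Pi_iff)
  also have "\<dots> = (\<Oplus>p\<in>?S'. ?f p) \<oplus> (\<Oplus>p\<in>?S'. ?g p)"
    using fc gc by (rule finsum_addf)
  finally show ?thesis unfolding f g .
qed

section \<open>Derivation rules and ring axioms for Hurwitz series\<close>

lemma hurwitz_deriv_add:
  "\<lbrakk>i < m; a \<in> carrier H; b \<in> carrier H\<rbrakk> \<Longrightarrow>
    hurwitz_deriv m i (a \<oplus>\<^bsub>H\<^esub> b) = hurwitz_deriv m i a \<oplus>\<^bsub>H\<^esub> hurwitz_deriv m i b"
  by (rule hurwitz_eqI) (auto simp: coeff_deriv coeff_add)

lemma hurwitz_deriv_mult: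
  "\<lbrakk>i < m; a \<in> carrier H; b \<in> carrier H\<rbrakk> \<Longrightarrow>
    hurwitz_deriv m i (a \<otimes>\<^bsub>H\<^esub> b)
    = (hurwitz_deriv m i a \<otimes>\<^bsub>H\<^esub> b) \<oplus>\<^bsub>H\<^esub> (a \<otimes>\<^bsub>H\<^esub> hurwitz_deriv m i b)"
  by (rule hurwitz_eqI) (auto simp: coeff_deriv coeff_add mult_coeff_Suc)

lemma hurwitz_deriv_zero: "i < m \<Longrightarrow> hurwitz_deriv m i \<zero>\<^bsub>H\<^esub> = \<zero>\<^bsub>H\<^esub>"
  by (rule hurwitz_eqI) (auto simp: coeff_deriv coeff_zero)

lemma hurwitz_deriv_one: "i < m \<Longrightarrow> hurwitz_deriv m i \<one>\<^bsub>H\<^esub> = \<zero>\<^bsub>H\<^esub>"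
  by (rule hurwitz_eqI) (simp_all add: coeff_deriv coeff_zero coeff_one del: fun_upd_apply)

text \<open>At a raised index the Leibniz rule splits both sides; the hypothesis applies once with
  \<open>a\<close> and \<open>b\<close> differentiated and once with \<open>c\<close>
  differentiated. Hence the induction generalizes over the series.\<close>

lemma mult_H_distrib:
  assumes "a \<in> carrier H" "b \<in> carrier H" "c \<in> carrier H"
  shows "(a \<oplus>\<^bsub>H\<^esub> b) \<otimes>\<^bsub>H\<^esub> c = (a \<otimes>\<^bsub>H\<^esub> c) \<oplus>\<^bsub>H\<^esub> (b \<otimes>\<^bsub>H\<^esub> c)"
proof (rule hurwitz_eqI)
  fix \<alpha> assume "\<alpha> \<in> multi_indices m"
  then show "((a \<oplus>\<^bsub>H\<^esub> b) \<otimes>\<^bsub>H\<^esub> c) \<alpha> = ((a \<otimes>\<^bsub>H\<^esub> c) \<oplus>\<^bsub>H\<^esub> (b \<otimes>\<^bsub>H\<^esub> c)) \<alpha>"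
    using assms
    by (induction arbitrary: a b c rule: multi_index_induct)
      (simp_all add: mult_coeff_zero coeff_add l_distr mult_coeff_Suc hurwitz_deriv_add a_ac)
qed (use assms in auto)

lemma mult_H_comm:
  assumes "a \<in> carrier H" "b \<in> carrier H"
  shows "a \<otimes>\<^bsub>H\<^esub> b = b \<otimes>\<^bsub>H\<^esub> a"
proof (rule hurwitz_eqI)
  fix \<alpha> assume "\<alpha> \<in> multi_indices m"
  then show "(a \<otimes>\<^bsub>H\<^esub> b) \<alpha> = (b \<otimes>\<^bsub>H\<^esub> a) \<alpha>"
    using assms
  proof (induction arbitrary: a b rule: multi_index_induct)
    case (Suc \<alpha> i)
    \<comment> \<open>The two Leibniz terms change places. Commutativity is permutative as a rewrite
      rule, so its two instances are supplied explicitly.\<close>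
    from Suc.IH[of "hurwitz_deriv m i a" b] Suc.IH[of a "hurwitz_deriv m i b"] Suc.hyps Suc.prems
    show ?case by (simp add: mult_coeff_Suc a_comm del: fun_upd_apply)
  qed (simp add: mult_coeff_zero m_comm)
qed (use assms in auto)

lemma mult_H_assoc:
  assumes "a \<in> carrier H" "b \<in> carrier H" "c \<in> carrier H"
  shows "(a \<otimes>\<^bsub>H\<^esub> b) \<otimes>\<^bsub>H\<^esub> c = a \<otimes>\<^bsub>H\<^esub> (b \<otimes>\<^bsub>H\<^esub> c)"
proof (rule hurwitz_eqI)
  \<comment> \<open>Distributivity in the second factor: differentiating
    \<open>b \<otimes> c\<close> puts a sum there.\<close>
  have distr: "x \<otimes>\<^bsub>H\<^esub> (y \<oplus>\<^bsub>H\<^esub> z) = (x \<otimes>\<^bsub>H\<^esub> y) \<oplus>\<^bsub>H\<^esub> (x \<otimes>\<^bsub>H\<^esub> z)"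
    if "x \<in> carrier H" "y \<in> carrier H" "z \<in> carrier H" for x y z
    using that by (metis mult_H_comm mult_H_distrib add_H_closed)
  fix \<alpha> assume "\<alpha> \<in> multi_indices m"
  then show "((a \<otimes>\<^bsub>H\<^esub> b) \<otimes>\<^bsub>H\<^esub> c) \<alpha> = (a \<otimes>\<^bsub>H\<^esub> (b \<otimes>\<^bsub>H\<^esub> c)) \<alpha>"
    using assms
    by (induction arbitrary: a b c rule: multi_index_induct)
      (simp_all add: mult_coeff_zero coeff_add m_assoc mult_coeff_Suc hurwitz_deriv_mult
        mult_H_distrib distr a_assoc)
qed (use assms in auto)

text \<open>Proved by hand ahead of the ring structure, because the unit law depends on it:
  \<open>d_i\<close> sends one to zero, which leaves a product with zero in the Leibniz
  rule.\<close>

lemma mult_H_zero: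
  assumes "a \<in> carrier H"
  shows "\<zero>\<^bsub>H\<^esub> \<otimes>\<^bsub>H\<^esub> a = \<zero>\<^bsub>H\<^esub>"
proof (rule hurwitz_eqI)
  fix \<alpha> assume "\<alpha> \<in> multi_indices m"
  then show "(\<zero>\<^bsub>H\<^esub> \<otimes>\<^bsub>H\<^esub> a) \<alpha> = \<zero>\<^bsub>H\<^esub> \<alpha>"
    using assms
    by (induction arbitrary: a rule: multi_index_induct)
      (simp_all add: mult_coeff_zero coeff_zero mult_coeff_Suc hurwitz_deriv_zero)
qed (use assms in auto)

lemma mult_H_one:
  assumes "a \<in> carrier H"
  shows "\<one>\<^bsub>H\<^esub> \<otimes>\<^bsub>H\<^esub> a = a"
proof (rule hurwitz_eqI)
  fix \<alpha> assume "\<alpha> \<in> multi_indices m"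
  then show "(\<one>\<^bsub>H\<^esub> \<otimes>\<^bsub>H\<^esub> a) \<alpha> = a \<alpha>"
    using assms
    by (induction arbitrary: a rule: multi_index_induct)
      (simp_all add: mult_coeff_zero coeff_one coeff_zero mult_coeff_Suc hurwitz_deriv_one
        mult_H_zero coeff_deriv)
qed (use assms in auto)

lemma cring_hurwitz_ring: "cring H"
proof (rule cringI)
  show "abelian_group H"
  proof (rule abelian_groupI)
    fix a assume a: "a \<in> carrier H"
    then show "\<exists>b\<in>carrier H. b \<oplus>\<^bsub>H\<^esub> a = \<zero>\<^bsub>H\<^esub>"
      by (intro bexI[of _ "\<lambda>\<alpha>\<in>multi_indices m. \<ominus> a \<alpha>"] hurwitz_eqI)
        (auto simp: coeff_add coeff_zero l_neg intro!: restrict_closed add_H_closed)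
  qed (auto intro!: hurwitz_eqI simp: coeff_add coeff_zero a_ac)
  show "comm_monoid H"
    by (rule comm_monoidI) (auto simp: mult_H_assoc mult_H_one intro: mult_H_comm)
qed (auto simp: mult_H_distrib)

lemma differential_ring_hurwitz_deriv: "differential_ring H m (hurwitz_deriv m)"
proof -
  interpret H: cring H by (rule cring_hurwitz_ring)
  show ?thesis
  proof unfold_locales
    fix i j a assume "i < m" "j < m" "a \<in> carrier H"
    then show "hurwitz_deriv m i (hurwitz_deriv m j a) = hurwitz_deriv m j (hurwitz_deriv m i a)"
      by (cases "i = j") (auto intro!: hurwitz_eqI simp: coeff_deriv fun_upd_twist)
  qed (auto simp: derivation_def hurwitz_deriv_add hurwitz_deriv_mult)
qed

lemma hurwitz_ev_hom: "hurwitz_ev \<in> ring_hom H K"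
  by (rule ring_hom_memI) (auto simp: hurwitz_ev_def mult_coeff_zero coeff_add coeff_one)

section \<open>Hurwitz morphisms\<close>

text \<open>The iterated Leibniz formula is never expanded. The image of \<open>a\<close> has
  constant term \<open>\<phi> a\<close>, and raising the index replaces \<open>a\<close> by
  \<open>D i a\<close>; the product in \<open>H\<close> obeys the same recursion.\<close>

lemma hurwitz_morphism_differential_ring_hom:
  assumes "differential_ring A m D" and "\<phi> \<in> ring_hom A K"
  shows "differential_ring_hom m A D H (hurwitz_deriv m) (hurwitz_morphism m D \<phi>)"
proof -
  interpret A: differential_ring A m D by fact
  interpret H: differential_ring H m "hurwitz_deriv m" by (rule differential_ring_hurwitz_deriv)
  interpret \<phi>: ring_hom_cring A K \<phi>
    using assms(2) by unfold_locales
  let ?h = "hurwitz_morphism m D \<phi>"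
  have closed: "?h a \<in> carrier H" if "a \<in> carrier A" for a
    unfolding hurwitz_morphism_def using that
    by (intro restrict_closed) (simp add: A.multi_deriv_closed)
  have zero: "?h a (\<lambda>_. 0) = \<phi> a" for a
    by (simp add: hurwitz_morphism_def A.multi_deriv_zero)
  have Suc: "?h a (\<alpha>(i := Suc (\<alpha> i))) = ?h (D i a) \<alpha>"
    if "a \<in> carrier A" "i < m" "\<alpha> \<in> multi_indices m" for a i \<alpha>
    using that by (simp add: hurwitz_morphism_def A.multi_deriv_Suc)
  have deriv: "?h (D i a) = hurwitz_deriv m i (?h a)" if "a \<in> carrier A" "i < m" for a i
    using that by (intro hurwitz_eqI) (simp_all add: closed coeff_deriv Suc)
  have add: "?h (a \<oplus>\<^bsub>A\<^esub> b) = ?h a \<oplus>\<^bsub>H\<^esub> ?h b" if "a \<in> carrier A" "b \<in> carrier A" for a b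
  proof (rule hurwitz_eqI)
    fix \<alpha> assume "\<alpha> \<in> multi_indices m"
    then show "?h (a \<oplus>\<^bsub>A\<^esub> b) \<alpha> = (?h a \<oplus>\<^bsub>H\<^esub> ?h b) \<alpha>"
      using that by (induction arbitrary: a b rule: multi_index_induct)
        (simp_all add: zero Suc coeff_add A.deriv_add)
  qed (use that in \<open>auto simp: closed\<close>)
  have mult: "?h (a \<otimes>\<^bsub>A\<^esub> b) = ?h a \<otimes>\<^bsub>H\<^esub> ?h b" if "a \<in> carrier A" "b \<in> carrier A" for a b
  proof (rule hurwitz_eqI)
    fix \<alpha> assume "\<alpha> \<in> multi_indices m"
    then show "?h (a \<otimes>\<^bsub>A\<^esub> b) \<alpha> = (?h a \<otimes>\<^bsub>H\<^esub> ?h b) \<alpha>"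
      using that by (induction arbitrary: a b rule: multi_index_induct)
        (simp_all add: zero mult_coeff_zero closed Suc A.deriv_mult add coeff_add
          mult_coeff_Suc deriv[symmetric])
  qed (use that in \<open>auto simp: closed\<close>)
  \<comment> \<open>Since \<open>D i \<one> = \<zero>\<close>, every nonconstant coefficient of the
    image of one is a coefficient of the image of zero.\<close>
  have null: "?h \<zero>\<^bsub>A\<^esub> \<alpha> = \<zero>" if "\<alpha> \<in> multi_indices m" for \<alpha>
    using that by (induction rule: multi_index_induct) (simp_all add: zero Suc A.deriv_zero del: fun_upd_apply)
  have one: "?h \<one>\<^bsub>A\<^esub> = \<one>\<^bsub>H\<^esub>"
  proof (rule hurwitz_eqI)
    fix \<alpha> assume "\<alpha> \<in> multi_indices m"
    then show "?h \<one>\<^bsub>A\<^esub> \<alpha> = \<one>\<^bsub>H\<^esub> \<alpha>"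
      by (cases rule: multi_index_induct)
        (simp_all add: zero Suc A.deriv_one coeff_one null del: fun_upd_apply)
  qed (auto simp: closed)
  show ?thesis
    unfolding differential_ring_hom_def
    using assms(1) H.differential_ring_axioms
    by (auto intro!: ring_hom_memI simp: closed add mult one deriv)
qed

section \<open>Twisted derivations\<close>

lemma twisted_deriv_eq:
  "twisted_deriv m K \<delta> i a = coeff_deriv m \<delta> i a \<oplus>\<^bsub>H\<^esub> hurwitz_deriv m i a"
  by (simp add: twisted_deriv_def add_family_def)

section \<open>Derivations acting on coefficients, and their sum with the shift derivations\<close>

context
  fixes \<delta> :: "nat \<Rightarrow> 'a \<Rightarrow> 'a"
  assumes \<delta>: "differential_ring K m \<delta>"
begin

interpretation \<delta>: differential_ring K m \<delta> by (rule \<delta>)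

text \<open>The doubled name avoids a clash: the rule \<open>coeff_deriv\<close> is about
  coefficients of \<open>hurwitz_deriv\<close>.\<close>

lemma coeff_coeff_deriv: "\<alpha> \<in> multi_indices m \<Longrightarrow> coeff_deriv m \<delta> i a \<alpha> = \<delta> i (a \<alpha>)"
  by (simp add: coeff_deriv_def)

lemma coeff_deriv_closed: "\<lbrakk>i < m; a \<in> carrier H\<rbrakk> \<Longrightarrow> coeff_deriv m \<delta> i a \<in> carrier H"
  unfolding coeff_deriv_def by (rule restrict_closed) simp

lemma coeff_deriv_add:
  "\<lbrakk>i < m; a \<in> carrier H; b \<in> carrier H\<rbrakk> \<Longrightarrow>
    coeff_deriv m \<delta> i (a \<oplus>\<^bsub>H\<^esub> b) = coeff_deriv m \<delta> i a \<oplus>\<^bsub>H\<^esub> coeff_deriv m \<delta> i b"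
  by (rule hurwitz_eqI) (auto simp: coeff_coeff_deriv coeff_add coeff_deriv_closed \<delta>.deriv_add)

lemma coeff_deriv_hurwitz_deriv:
  "\<lbrakk>i < m; j < m; a \<in> carrier H\<rbrakk> \<Longrightarrow>
    coeff_deriv m \<delta> i (hurwitz_deriv m j a) = hurwitz_deriv m j (coeff_deriv m \<delta> i a)"
  by (rule hurwitz_eqI) (auto simp: coeff_coeff_deriv coeff_deriv coeff_deriv_closed)

lemma coeff_deriv_commute:
  "\<lbrakk>i < m; j < m; a \<in> carrier H\<rbrakk> \<Longrightarrow>
    coeff_deriv m \<delta> i (coeff_deriv m \<delta> j a) = coeff_deriv m \<delta> j (coeff_deriv m \<delta> i a)"
  by (rule hurwitz_eqI) (auto simp: coeff_coeff_deriv coeff_deriv_closed \<delta>.commute)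

text \<open>The constant term is the Leibniz rule in \<open>K\<close>. In the step
  \<open>\<delta>_i\<close> commutes with \<open>d_j\<close>, and both sides expand into the same
  four products by the hypothesis for the two pairs with one factor differentiated.\<close>

lemma coeff_deriv_mult:
  assumes i: "i < m" and "a \<in> carrier H" "b \<in> carrier H"
  shows "coeff_deriv m \<delta> i (a \<otimes>\<^bsub>H\<^esub> b)
    = (coeff_deriv m \<delta> i a \<otimes>\<^bsub>H\<^esub> b) \<oplus>\<^bsub>H\<^esub> (a \<otimes>\<^bsub>H\<^esub> coeff_deriv m \<delta> i b)"
proof (rule hurwitz_eqI)
  fix \<alpha> assume "\<alpha> \<in> multi_indices m"
  then show "coeff_deriv m \<delta> i (a \<otimes>\<^bsub>H\<^esub> b) \<alpha> =
      ((coeff_deriv m \<delta> i a \<otimes>\<^bsub>H\<^esub> b) \<oplus>\<^bsub>H\<^esub> (a \<otimes>\<^bsub>H\<^esub> coeff_deriv m \<delta> i b)) \<alpha>"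
    using assms(2,3)
  proof (induction arbitrary: a b rule: multi_index_induct)
    case zero
    then show ?case
      using i by (simp add: coeff_coeff_deriv coeff_add mult_coeff_zero coeff_deriv_closed \<delta>.deriv_mult)
  next
    case (Suc \<alpha> j)
    from Suc.IH[of "hurwitz_deriv m j a" b] Suc.IH[of a "hurwitz_deriv m j b"] Suc.hyps Suc.prems i
    show ?case
      by (simp add: coeff_coeff_deriv coeff_add mult_coeff_Suc coeff_deriv_closed \<delta>.deriv_add
          coeff_deriv_hurwitz_deriv a_ac del: fun_upd_apply)
  qed
qed (use assms in \<open>auto simp: coeff_deriv_closed\<close>)

text \<open>Leibniz rules add up. For commutation, each composite expands into four terms, and the
  mixed ones match because every \<open>\<delta>_i\<close> commutes with every
  \<open>d_j\<close>.\<close>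

lemma differential_ring_twisted_deriv: "differential_ring H m (twisted_deriv m K \<delta>)"
proof -
  interpret H: differential_ring H m "hurwitz_deriv m" by (rule differential_ring_hurwitz_deriv)
  show ?thesis
  proof unfold_locales
    fix i assume "i < m"
    then show "derivation H (twisted_deriv m K \<delta> i)"
      by (auto simp: derivation_def twisted_deriv_eq coeff_deriv_closed coeff_deriv_add
          coeff_deriv_mult hurwitz_deriv_add hurwitz_deriv_mult H.l_distr H.r_distr H.a_ac)
  next
    fix i j a assume "i < m" "j < m" "a \<in> carrier H"
    then show "twisted_deriv m K \<delta> i (twisted_deriv m K \<delta> j a)
        = twisted_deriv m K \<delta> j (twisted_deriv m K \<delta> i a)"
      by (simp add: twisted_deriv_eq coeff_deriv_closed coeff_deriv_add hurwitz_deriv_add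
          coeff_deriv_hurwitz_deriv coeff_deriv_commute[of i j] H.commute[of i j] H.a_ac)
  qed
qed

lemma hurwitz_morphism_twisted_deriv_hom:
  "differential_ring_hom m H (twisted_deriv m K \<delta>) H (hurwitz_deriv m)
    (hurwitz_morphism m (twisted_deriv m K \<delta>) hurwitz_ev)"
  by (rule hurwitz_morphism_differential_ring_hom[OF differential_ring_twisted_deriv hurwitz_ev_hom])

text \<open>\<open>\<delta>_i\<close> commutes with all twisted derivations, hence with their
  iterates, and taking the constant term carries \<open>\<delta>_i\<close> on series to
  \<open>\<delta>_i\<close> on \<open>K\<close>.\<close>

lemma hurwitz_morphism_coeff_deriv:
  assumes "i < m" "a \<in> carrier H"
  shows "hurwitz_morphism m (twisted_deriv m K \<delta>) hurwitz_ev (coeff_deriv m \<delta> i a)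
    = coeff_deriv m \<delta> i (hurwitz_morphism m (twisted_deriv m K \<delta>) hurwitz_ev a)"
proof -
  interpret T: differential_ring H m "twisted_deriv m K \<delta>" by (rule differential_ring_twisted_deriv)
  have "coeff_deriv m \<delta> i (multi_deriv m (twisted_deriv m K \<delta>) \<alpha> a)
      = multi_deriv m (twisted_deriv m K \<delta>) \<alpha> (coeff_deriv m \<delta> i a)" for \<alpha>
    using assms by (intro T.multi_deriv_commute)
      (auto simp: coeff_deriv_closed twisted_deriv_eq coeff_deriv_add coeff_deriv_hurwitz_deriv
        coeff_deriv_commute[of i])
  then show ?thesis
    by (auto simp: hurwitz_morphism_def hurwitz_ev_def coeff_coeff_deriv[symmetric]
        coeff_deriv_def[of m \<delta> i "restrict _ _"] intro!: restrict_ext)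
qed

end

text \<open>Two families cancelling each other, in place of one family and its negative, make both
  composites instances of the same statement and avoid a double negation.\<close>

lemma hurwitz_morphism_inverse:
  assumes \<delta>: "differential_ring K m \<delta>" and \<epsilon>: "differential_ring K m \<epsilon>"
    and opp: "\<And>i x. \<lbrakk>i < m; x \<in> carrier K\<rbrakk> \<Longrightarrow> \<epsilon> i x \<oplus> \<delta> i x = \<zero>"
    and a: "a \<in> carrier H"
  shows "hurwitz_morphism m (twisted_deriv m K \<epsilon>) hurwitz_ev
    (hurwitz_morphism m (twisted_deriv m K \<delta>) hurwitz_ev a) = a"
proof -
  interpret \<delta>: differential_ring K m \<delta> by (rule \<delta>)
  interpret \<epsilon>: differential_ring K m \<epsilon> by (rule \<epsilon>)
  interpret T\<delta>: differential_ring H m "twisted_deriv m K \<delta>"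
    by (rule differential_ring_twisted_deriv[OF \<delta>])
  interpret T\<epsilon>: differential_ring H m "twisted_deriv m K \<epsilon>"
    by (rule differential_ring_twisted_deriv[OF \<epsilon>])
  let ?F = "hurwitz_morphism m (twisted_deriv m K \<delta>) hurwitz_ev"
  let ?G = "hurwitz_morphism m (twisted_deriv m K \<epsilon>) hurwitz_ev"
  note F = hurwitz_morphism_twisted_deriv_hom[OF \<delta>, unfolded differential_ring_hom_def]
  note G = hurwitz_morphism_twisted_deriv_hom[OF \<epsilon>, unfolded differential_ring_hom_def]
  have Fc: "?F x \<in> carrier H" if "x \<in> carrier H" for x using F that ring_hom_closed by metis
  have Gc: "?G x \<in> carrier H" if "x \<in> carrier H" for x using G that ring_hom_closed by metis
  have F_deriv: "?F (hurwitz_deriv m i x) = twisted_deriv m K \<epsilon> i (?F x)"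
    if "i < m" "x \<in> carrier H" for i x
  proof -
    have Fadd: "?F (twisted_deriv m K \<delta> i x) = ?F (coeff_deriv m \<delta> i x) \<oplus>\<^bsub>H\<^esub> ?F (hurwitz_deriv m i x)"
      unfolding twisted_deriv_eq[of \<delta> i x] using F that
      by (simp add: ring_hom_add[of ?F H H] coeff_deriv_closed[OF \<delta>])
    have "hurwitz_deriv m i (?F x) = coeff_deriv m \<delta> i (?F x) \<oplus>\<^bsub>H\<^esub> ?F (hurwitz_deriv m i x)"
      using F that Fadd by (simp add: hurwitz_morphism_coeff_deriv[OF \<delta>])
    \<comment> \<open>Adding the \<epsilon> term on both sides amounts to subtracting the \<delta>
      term.\<close>
    then have "twisted_deriv m K \<epsilon> i (?F x) = (coeff_deriv m \<epsilon> i (?F x) \<oplus>\<^bsub>H\<^esub> coeff_deriv m \<delta> i (?F x))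
        \<oplus>\<^bsub>H\<^esub> ?F (hurwitz_deriv m i x)"
      unfolding twisted_deriv_eq[of \<epsilon>] using that
      by (simp add: T\<delta>.a_assoc Fc coeff_deriv_closed[OF \<delta>] coeff_deriv_closed[OF \<epsilon>])
    also have "coeff_deriv m \<epsilon> i (?F x) \<oplus>\<^bsub>H\<^esub> coeff_deriv m \<delta> i (?F x) = \<zero>\<^bsub>H\<^esub>"
      using that by (intro hurwitz_eqI)
        (simp_all add: Fc coeff_deriv_closed[OF \<delta>] coeff_deriv_closed[OF \<epsilon>] coeff_add coeff_zero
          coeff_coeff_deriv[OF \<delta>] coeff_coeff_deriv[OF \<epsilon>] opp)
    finally show ?thesis using that by (simp add: Fc)
  qed
  show ?thesis
  proof (rule hurwitz_eqI)
    fix \<alpha> assume "\<alpha> \<in> multi_indices m"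
    then show "?G (?F a) \<alpha> = a \<alpha>"
      using a
    proof (induction arbitrary: a rule: multi_index_induct)
      case zero
      show ?case
        by (simp add: hurwitz_morphism_def T\<delta>.multi_deriv_zero T\<epsilon>.multi_deriv_zero hurwitz_ev_def)
    next
      case (Suc \<alpha> i)
      \<comment> \<open>\<open>d_i\<close> passes inward through \<open>?G\<close>, becoming the
        \<epsilon>-twisted derivation, and then through \<open>?F\<close>, becoming
        \<open>d_i\<close> again; the hypothesis is used for
        \<open>hurwitz_deriv m i a\<close>.\<close>
      have "?G (?F a) (\<alpha>(i := Suc (\<alpha> i))) = hurwitz_deriv m i (?G (?F a)) \<alpha>"
        using Suc by (simp add: coeff_deriv)
      also have "\<dots> = ?G (twisted_deriv m K \<epsilon> i (?F a)) \<alpha>"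
        using G Suc Fc by simp
      also have "\<dots> = ?G (?F (hurwitz_deriv m i a)) \<alpha>"
        using Suc by (simp add: F_deriv)
      also have "\<dots> = a (\<alpha>(i := Suc (\<alpha> i)))"
        using Suc by (simp add: coeff_deriv)
      finally show ?case .
    qed
  qed (use a in \<open>auto simp: Fc Gc\<close>)
qed

end

theorem corollary9p3:
  fixes K :: "('a, 'b) ring_scheme" and m :: nat and \<delta> :: "nat \<Rightarrow> 'a \<Rightarrow> 'a"
  assumes "differential_ring K m \<delta>"
  shows "differential_ring_iso m
           (hurwitz_ring m K) (twisted_deriv m K \<delta>)
           (hurwitz_ring m K) (hurwitz_deriv m)
           (hurwitz_morphism m (twisted_deriv m K \<delta>) hurwitz_ev)
       \<and> (\<forall>a\<in>carrier (hurwitz_ring m K).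
            hurwitz_morphism m (twisted_deriv m K (neg_family K \<delta>)) hurwitz_ev
              (hurwitz_morphism m (twisted_deriv m K \<delta>) hurwitz_ev a) = a)
       \<and> (\<forall>a\<in>carrier (hurwitz_ring m K).
            hurwitz_morphism m (twisted_deriv m K \<delta>) hurwitz_ev
              (hurwitz_morphism m (twisted_deriv m K (neg_family K \<delta>)) hurwitz_ev a) = a)"
proof -
  interpret \<delta>: differential_ring K m \<delta> by fact
  interpret hurwitz_series K m ..
  let ?H = "hurwitz_ring m K"
  let ?F = "hurwitz_morphism m (twisted_deriv m K \<delta>) hurwitz_ev"
  let ?G = "hurwitz_morphism m (twisted_deriv m K (neg_family K \<delta>)) hurwitz_ev"
  note neg = \<delta>.differential_ring_neg_family
  \<comment> \<open>The open slot in the chained facts is the cancellation premise, left to the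
    closing simplification; \<open>FG\<close> below exchanges the two families.\<close>
  have GF: "?G (?F a) = a" if "a \<in> carrier ?H" for a
    using assms neg _ that
    by (rule hurwitz_morphism_inverse) (simp add: neg_family_def \<delta>.l_neg)
  have FG: "?F (?G a) = a" if "a \<in> carrier ?H" for a
    using neg assms _ that
    by (rule hurwitz_morphism_inverse) (simp add: neg_family_def \<delta>.r_neg)
  have F: "differential_ring_hom m ?H (twisted_deriv m K \<delta>) ?H (hurwitz_deriv m) ?F"
    by (rule hurwitz_morphism_twisted_deriv_hom[OF assms])
  have G: "differential_ring_hom m ?H (twisted_deriv m K (neg_family K \<delta>)) ?H (hurwitz_deriv m) ?G"
    by (rule hurwitz_morphism_twisted_deriv_hom[OF neg])
  have "?F \<in> carrier ?H \<rightarrow> carrier ?H" "?G \<in> carrier ?H \<rightarrow> carrier ?H"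
    using F G by (auto simp: differential_ring_hom_def ring_hom_def)
  then have "bij_betw ?F (carrier ?H) (carrier ?H)"
    using GF FG by (intro bij_betwI[where g = ?G]) auto
  then show ?thesis
    using F GF FG by (auto simp: differential_ring_iso_def)
qed

end
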